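(* Let $\mathcal{H},\mathcal{X},\mathcal{X}_0,\mathcal{W}_0,\mathbf{E},\mathbf{D},\mathbf{C},g,f,\mathcal{U},\mathcal{V},G,Q$ be as in the context. A function $\bm{\widetilde\sigma}(t)$, $t\in I$, with values in $\mathcal H$, is a stress solution for elasticity if and only if for all $t\in I$ $$\bm{\widetilde\sigma}(t)\in(\mathcal{U}+G\,\bm g(t))\cap(\mathcal{V}+Q\,\bm f(t)).$$ For each $t\in I$ this inclusion has exactly one solution, namely $$\bm{\widetilde\sigma}(t)=G\,\bm g(t)+Q\,\bm f(t).$$
   Context: All spaces are real and $I=[0,T]$ with $T>0$. For a function $h$ on $I$, $\bm h(t)$ denotes its value at $t$. Spaces and operators. $\mathcal{H}$ is a Hilbert space, $\mathcal{X}$ is a reflexive Banach space, $\mathcal{W}_0\subset\mathcal{X}$ is a linear (not necessarily closed) subspace, $\mathbf{E}:\mathcal{W}_0\subset\mathcal{X}\to\mathcal{H}$ is a linear operator which is closed (closed graph in $\mathcal X\times\mathcal H$) and has closed image. $\mathcal{X}_0=\overline{\mathcal{W}_0}$ (closure in $\mathcal{X}$). $\mathbf{D}:D(\mathbf{D})\subset\mathcal{H}\to\mathcal{X}_0^*$ is the adjoint, in the sense of unbounded operators, of $\mathbf{E}$ regarded as a densely defined operator from $\mathcal{X}_0$ to $\mathcal{H}$: $D(\mathbf D)$ is the set of $\bm\tau\in\mathcal H$ for which there is $c\ge 0$ with $|\langle\bm\tau,\mathbf E\bm u\rangle_{\mathcal H}|\le c\|\bm u\|_{\mathcal X}$ for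 all $\bm u\in\mathcal W_0$, and $\mathbf D\bm\tau$ is the continuous extension to $\mathcal X_0$ of $\bm u\mapsto\langle\bm\tau,\mathbf E\bm u\rangle_{\mathcal H}$. $\mathbf{C}:\mathcal{H}\to\mathcal{H}$ is linear, bounded, symmetric, and coercive ($\langle\mathbf C\bm\tau,\bm\tau\rangle\ge c_0\|\bm\tau\|^2$ for some $c_0>0$ and all $\bm\tau$). The loads are $g\in W^{1,\infty}(I,\mathcal{H})$ and $f\in W^{1,\infty}(I,\mathrm{Im}\,\mathbf{D})$. Stress solution for elasticity. The functions $\widetilde\varepsilon,\widetilde\sigma\in W^{1,\infty}(I,\mathcal{H})$ solve the abstract problem of quasi-static evolution in elasticity if for all $t\in I$: (EL1) $\bm{\widetilde\varepsilon}(t)\in\mathrm{Im}\,\mathbf{E}+\bm g(t)$; (EL2) $\bm{\widetilde\sigma}(t)=\mathbf{C}\,\bm{\widetilde\varepsilon}(t)$; (EL3) $\bm{\widetilde\sigma}(t)\in D(\mathbf{D})$ and $\mathbf{D}\,\bm{\widetilde\sigma}(t)=\bm f(t)$. Then $\widetilde\sigma$ is called a stress solution for elasticity. Weighted space. $\mathcal{H}_{\mathbf{C}^{-1}}$ is $\mathcal{H}$ with the inner product $\langle\bm\sigma,\bm\tau\rangle_{\mathbf{C}^{-1}}=\langle\bm\sigma,\mathbf{C}^{-1}\bm\tau\rangle_{\mathcal{H}}$. $\mathcal{U}=\mathrm{Im}(\mathbf{C}\mathbf{E})$ and $\mathcal{V}=\mathrm{Ker}\,\mathbf{D}$; these are closed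 orthogonal complements of each other in $\mathcal{H}_{\mathbf{C}^{-1}}$. $P_{\mathcal V}$ is the orthogonal projection of $\mathcal{H}_{\mathbf{C}^{-1}}$ onto $\mathcal{V}$. $G=P_{\mathcal V}\mathbf{C}:\mathcal{H}\to\mathcal{V}$. $Q:\mathrm{Im}\,\mathbf{D}\to\mathcal{U}$ is the (bounded) inverse of the bijection $\mathcal{U}\cap D(\mathbf{D})\to\mathrm{Im}\,\mathbf{D}$, $\bm\sigma\mapsto\mathbf{D}\bm\sigma$. *)

theory Defs
  imports "HOL-Analysis.Analysis"
begin

section \<open>Functional-analytic notions\<close>

definition reflexive_space :: "'x::banach itself \<Rightarrow> bool" where
  "reflexive_space _ \<longleftrightarrow>
     (\<forall>F :: ('x \<Rightarrow>\<^sub>L real) \<Rightarrow>\<^sub>L real. \<exists>x. \<forall>\<phi>. blinfun_apply F \<phi> = blinfun_apply \<phi> x)"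

text \<open>An unbounded operator is a total function together with its domain; the values off the
  domain are irrelevant.\<close>

definition linear_on_subspace :: "'x::real_vector set \<Rightarrow> ('x \<Rightarrow> 'h::real_vector) \<Rightarrow> bool" where
  "linear_on_subspace W E \<longleftrightarrow> subspace W \<and>
     (\<forall>u\<in>W. \<forall>v\<in>W. E (u + v) = E u + E v) \<and> (\<forall>c. \<forall>u\<in>W. E (c *\<^sub>R u) = c *\<^sub>R E u)"

definition closed_operator ::
    "'x::topological_space set \<Rightarrow> ('x \<Rightarrow> 'h::topological_space) \<Rightarrow> bool" where
  "closed_operator W E \<longleftrightarrow> closed {(u, E u) | u. u \<in> W}"

text \<open>The closed subspace \<open>closure W\<close> of \<open>'x\<close> depends on a term, so its dual cannot be formed
  directly as a type.  A Banach space \<open>'x0\<close> with a linear isometry \<open>J\<close> onto \<open>closure W\<close> plays the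
  role of that subspace, and \<open>'x0 \<Rightarrow>\<^sub>L real\<close> is its normed dual.\<close>

definition isometry_onto :: "('x0::real_normed_vector \<Rightarrow> 'x::real_normed_vector) \<Rightarrow> 'x set \<Rightarrow> bool" where
  "isometry_onto J S \<longleftrightarrow> linear J \<and> (\<forall>x. norm (J x) = norm x) \<and> range J = S"

definition bounded_symmetric_coercive :: "('h::real_inner \<Rightarrow> 'h) \<Rightarrow> bool" where
  "bounded_symmetric_coercive C \<longleftrightarrow> bounded_linear C \<and> (\<forall>\<sigma> \<tau>. C \<sigma> \<bullet> \<tau> = \<sigma> \<bullet> C \<tau>) \<and>
     (\<exists>c0>0. \<forall>\<tau>. C \<tau> \<bullet> \<tau> \<ge> c0 * (norm \<tau>)\<^sup>2)"

section \<open>Sobolev functions of one real variable with values in a Banach space\<close>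

text \<open>The target space is a closed linear subspace \<open>Y\<close> of the ambient Banach space.  The library's
  Bochner integral and Borel measurability are tied to second countable targets, whereas the
  spaces here may be nonseparable; hence measurability is strong (Bochner) measurability.\<close>

definition strongly_measurable_in ::
    "real set \<Rightarrow> 'b::real_normed_vector set \<Rightarrow> (real \<Rightarrow> 'b) \<Rightarrow> bool" where
  "strongly_measurable_in I Y u \<longleftrightarrow> (\<exists>s :: nat \<Rightarrow> real \<Rightarrow> 'b.
     (\<forall>n. simple_function (lebesgue_on I) (s n) \<and> s n ` I \<subseteq> Y) \<and>
     (AE t in lebesgue_on I. (\<lambda>n. s n t) \<longlonglongrightarrow> u t))"

definition Linfty :: "real set \<Rightarrow> 'b::real_normed_vector set \<Rightarrow> (real \<Rightarrow> 'b) set" where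
  "Linfty I Y = {u. u ` I \<subseteq> Y \<and> strongly_measurable_in I Y u \<and>
     (\<exists>K. AE t in lebesgue_on I. norm (u t) \<le> K)}"

text \<open>\<open>C\<^sub>c\<^sup>\<infinity>\<close> functions on the open interval from \<open>a\<close> to \<open>b\<close>.\<close>

definition test_functions :: "real \<Rightarrow> real \<Rightarrow> (real \<Rightarrow> real) set" where
  "test_functions a b = {\<phi>. (\<forall>n t. (deriv ^^ n) \<phi> field_differentiable at t) \<and>
     (\<exists>K. compact K \<and> K \<subseteq> {a<..<b} \<and> (\<forall>t. t \<notin> K \<longrightarrow> \<phi> t = 0))}"

text \<open>The integrals are Henstock--Kurzweil integrals; on essentially bounded strongly measurable
  functions these exist and agree with the Bochner integral.\<close>

definition weak_derivative ::
    "real \<Rightarrow> real \<Rightarrow> (real \<Rightarrow> 'b::real_normed_vector) \<Rightarrow> (real \<Rightarrow> 'b) \<Rightarrow> bool" where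
  "weak_derivative a b h u \<longleftrightarrow> (\<forall>\<phi>\<in>test_functions a b. \<exists>A.
     ((\<lambda>t. deriv \<phi> t *\<^sub>R h t) has_integral A) {a..b} \<and>
     ((\<lambda>t. \<phi> t *\<^sub>R u t) has_integral (- A)) {a..b})"

text \<open>Elements of the Sobolev space are evaluated at every point, so they are represented by their
  continuous representatives.\<close>

definition W1infty :: "real \<Rightarrow> real \<Rightarrow> 'b::real_normed_vector set \<Rightarrow> (real \<Rightarrow> 'b) set" where
  "W1infty a b Y = {h. continuous_on {a..b} h \<and> h \<in> Linfty {a..b} Y \<and>
     (\<exists>u\<in>Linfty {a..b} Y. weak_derivative a b h u)}"

section \<open>The adjoint operator\<close>

text \<open>The subspace \<open>W\<close> lies in \<open>'x\<close>; its preimage under \<open>J\<close> is dense in \<open>'x0\<close>, so the bounded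
  functional in \<open>adj\<close>, the continuous extension of \<open>u \<mapsto> \<tau> \<bullet> E u\<close>, exists uniquely for \<open>\<tau>\<close> in \<open>dom_adj\<close>.\<close>

definition dom_adj :: "'x::real_normed_vector set \<Rightarrow> ('x \<Rightarrow> 'h::real_inner) \<Rightarrow> 'h set" where
  "dom_adj W E = {\<tau>. \<exists>c\<ge>0. \<forall>u\<in>W. \<bar>\<tau> \<bullet> E u\<bar> \<le> c * norm u}"

definition adj :: "('x0::real_normed_vector \<Rightarrow> 'x) \<Rightarrow> 'x::real_normed_vector set \<Rightarrow>
    ('x \<Rightarrow> 'h::real_inner) \<Rightarrow> 'h \<Rightarrow> ('x0 \<Rightarrow>\<^sub>L real)" where
  "adj J W E \<tau> = (THE \<phi>. \<forall>x. J x \<in> W \<longrightarrow> blinfun_apply \<phi> x = \<tau> \<bullet> E (J x))"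

definition im_adj :: "('x0::real_normed_vector \<Rightarrow> 'x) \<Rightarrow> 'x::real_normed_vector set \<Rightarrow>
    ('x \<Rightarrow> 'h::real_inner) \<Rightarrow> ('x0 \<Rightarrow>\<^sub>L real) set" where
  "im_adj J W E = adj J W E ` dom_adj W E"

definition V_space :: "('x0::real_normed_vector \<Rightarrow> 'x) \<Rightarrow> 'x::real_normed_vector set \<Rightarrow>
    ('x \<Rightarrow> 'h::real_inner) \<Rightarrow> 'h set" where
  "V_space J W E = {\<tau> \<in> dom_adj W E. adj J W E \<tau> = 0}"

section \<open>The weighted space and the operators \<open>G\<close> and \<open>Q\<close>\<close>

definition inner_weighted :: "('h::real_inner \<Rightarrow> 'h) \<Rightarrow> 'h \<Rightarrow> 'h \<Rightarrow> real" where
  "inner_weighted C \<sigma> \<tau> = \<sigma> \<bullet> inv C \<tau>"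

definition proj_weighted :: "('h::real_inner \<Rightarrow> 'h) \<Rightarrow> 'h set \<Rightarrow> 'h \<Rightarrow> 'h" where
  "proj_weighted C V \<sigma> = (THE v. v \<in> V \<and> (\<forall>w\<in>V. inner_weighted C (\<sigma> - v) w = 0))"

definition U_space :: "'x set \<Rightarrow> ('x \<Rightarrow> 'h) \<Rightarrow> ('h \<Rightarrow> 'h) \<Rightarrow> 'h set" where
  "U_space W E C = (\<lambda>u. C (E u)) ` W"

definition G_op :: "('x0::real_normed_vector \<Rightarrow> 'x) \<Rightarrow> 'x::real_normed_vector set \<Rightarrow>
    ('x \<Rightarrow> 'h::real_inner) \<Rightarrow> ('h \<Rightarrow> 'h) \<Rightarrow> 'h \<Rightarrow> 'h" where
  "G_op J W E C \<tau> = proj_weighted C (V_space J W E) (C \<tau>)"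

definition Q_op :: "('x0::real_normed_vector \<Rightarrow> 'x) \<Rightarrow> 'x::real_normed_vector set \<Rightarrow>
    ('x \<Rightarrow> 'h::real_inner) \<Rightarrow> ('h \<Rightarrow> 'h) \<Rightarrow> ('x0 \<Rightarrow>\<^sub>L real) \<Rightarrow> 'h" where
  "Q_op J W E C = the_inv_into (U_space W E C \<inter> dom_adj W E) (adj J W E)"

section \<open>Quasi-static evolution in elasticity\<close>

definition solves_elasticity :: "real \<Rightarrow> ('x0::real_normed_vector \<Rightarrow> 'x) \<Rightarrow>
    'x::real_normed_vector set \<Rightarrow> ('x \<Rightarrow> 'h::real_inner) \<Rightarrow> ('h \<Rightarrow> 'h) \<Rightarrow>
    (real \<Rightarrow> 'h) \<Rightarrow> (real \<Rightarrow> ('x0 \<Rightarrow>\<^sub>L real)) \<Rightarrow> (real \<Rightarrow> 'h) \<Rightarrow> (real \<Rightarrow> 'h) \<Rightarrow> bool" where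
  "solves_elasticity T J W E C g f \<epsilon> \<sigma> \<longleftrightarrow>
     \<epsilon> \<in> W1infty 0 T UNIV \<and> \<sigma> \<in> W1infty 0 T UNIV \<and>
     (\<forall>t\<in>{0..T}.
        \<epsilon> t \<in> (\<lambda>e. e + g t) ` (E ` W) \<and>
        \<sigma> t = C (\<epsilon> t) \<and>
        \<sigma> t \<in> dom_adj W E \<and> adj J W E (\<sigma> t) = f t)"

definition stress_solution :: "real \<Rightarrow> ('x0::real_normed_vector \<Rightarrow> 'x) \<Rightarrow>
    'x::real_normed_vector set \<Rightarrow> ('x \<Rightarrow> 'h::real_inner) \<Rightarrow> ('h \<Rightarrow> 'h) \<Rightarrow>
    (real \<Rightarrow> 'h) \<Rightarrow> (real \<Rightarrow> ('x0 \<Rightarrow>\<^sub>L real)) \<Rightarrow> (real \<Rightarrow> 'h) \<Rightarrow> bool" where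
  "stress_solution T J W E C g f \<sigma> \<longleftrightarrow> (\<exists>\<epsilon>. solves_elasticity T J W E C g f \<epsilon> \<sigma>)"

end

theory Submission
  imports Defs
begin

text \<open>Since \<open>C\<close> is coercive, minimising an energy over the closed range of \<open>E\<close> splits \<open>'h\<close> into \<open>U\<close> and
  \<open>V\<close>, which are orthogonal in the weighted inner product. Hence \<open>\<sigma> t \<in> U + G (g t)\<close> amounts to (EL1)
  for \<open>inv C (\<sigma> t)\<close>, and \<open>\<sigma> t \<in> V + Q (f t)\<close> to (EL3). The Sobolev regularity of
  \<open>G (g t) + Q (f t)\<close> comes from boundedness of \<open>G\<close> and \<open>Q\<close>; for \<open>Q\<close> this is the uniform boundedness
  principle on the range of \<open>E\<close>.\<close>

text \<open>A stress solution is required to have Sobolev regularity in time, whereas the inclusion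
  is a condition at each single time. The two agree because the intersection is one point, depending
  on \<open>g t\<close> and \<open>f t\<close> through fixed bounded linear maps:
  \<open>G \<tau>\<close> is the \<open>V\<close> component of \<open>C \<tau>\<close>, and
  \<open>Q \<phi>\<close> is the \<open>U\<close> component of any preimage of \<open>\<phi>\<close>
  under the adjoint. The strain is eliminated, since (EL2) forces it to be
  \<open>inv C (\<sigma> t)\<close>. The obstacle is that \<open>Q\<close> is meaningful only on
  \<open>im_adj J W E\<close>, a subspace of the dual; its values elsewhere are arbitrary.
  Regularity is therefore transferred along maps that are linear and bounded on a subspace only.
  Integrals of functions with values in a subspace are limits of Riemann sums, hence lie in its
  closure, so the map is first extended there by continuity.\<close>

section \<open>Bounded linear maps on subspaces\<close>

text \<open>The Banach space in question is a set rather than a type, so the category argument runs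
  in the subspace topology of \<open>S\<close>, which is completely metrizable because
  \<open>S\<close> is closed. A relative ball on which the whole family is bounded by
  \<open>n\<close> is moved to the origin by subtracting its centre.\<close>

lemma uniform_boundedness_subspace:
  fixes S :: "'a::{real_normed_vector, complete_space} set"
    and F :: "'i \<Rightarrow> 'a \<Rightarrow> 'b::real_normed_vector"
  assumes S: "subspace S" "closed S"
    and lin: "\<And>i. i \<in> I \<Longrightarrow> bounded_linear (F i)"
    and bdd: "\<And>x. x \<in> S \<Longrightarrow> \<exists>K. \<forall>i\<in>I. norm (F i x) \<le> K"
  obtains K where "\<And>i x. i \<in> I \<Longrightarrow> x \<in> S \<Longrightarrow> norm (F i x) \<le> K * norm x"
proof -
  define L where "L n = {x \<in> S. \<forall>i\<in>I. norm (F i x) \<le> real n}" for n :: nat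
  have closedL: "closedin (top_of_set S) (L n)" for n
  proof -
    have "L n = S \<inter> (\<Inter>i\<in>I. {x. norm (F i x) \<le> real n})"
      by (auto simp: L_def)
    moreover have "closed {x. norm (F i x) \<le> real n}" if "i \<in> I" for i
      by (intro closed_Collect_le continuous_on_norm continuous_on_const
          linear_continuous_on lin that)
    ultimately have "closed (L n)"
      using S(2) by (auto intro!: closed_Int closed_INT)
    then show ?thesis
      by (auto simp: L_def intro!: closed_subset)
  qed
  have "\<Union>(range L) = S"
  proof -
    have "x \<in> \<Union>(range L)" if "x \<in> S" for x
    proof -
      obtain K where K: "\<forall>i\<in>I. norm (F i x) \<le> K" using bdd[OF \<open>x \<in> S\<close>] by auto
      then have "x \<in> L (nat \<lceil>K\<rceil>)"
        using that unfolding L_def by (auto intro: order_trans real_nat_ceiling_ge)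
      then show ?thesis by blast
    qed
    then show ?thesis by (auto simp: L_def)
  qed
  \<comment> \<open>Baire in contrapositive form: if every \<open>L n\<close> had empty interior
    relative to \<open>S\<close>, so would their union \<open>S\<close>; but \<open>S\<close> is
    open in itself and contains 0.\<close>
  then have "(top_of_set S) interior_of \<Union>(range L) = S"
    by (metis interior_of_topspace topspace_euclidean_subtopology)
  moreover have "0 \<in> S" using S(1) by (rule subspace_0)
  moreover have "completely_metrizable_space (top_of_set S)"
    by (simp add: S(2) completely_metrizable_space_closedin completely_metrizable_space_euclidean)
  ultimately have "\<not> (\<forall>n. (top_of_set S) interior_of (L n) = {})"
    using Baire_category_alt[of "top_of_set S" "range L"] closedL by auto
  then obtain n a where a: "a \<in> (top_of_set S) interior_of (L n)" by auto
  then obtain U where U: "openin (top_of_set S) U" "a \<in> U" "U \<subseteq> L n"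
    unfolding interior_of_def by auto
  then obtain e where e: "e > 0" "ball a e \<inter> S \<subseteq> U"
    unfolding openin_contains_ball by blast
  have aS: "a \<in> S" using U by (auto simp: L_def)
  have "norm (F i x) \<le> (4 * real n / e) * norm x" if i: "i \<in> I" and x: "x \<in> S" for i x
  proof (cases "x = 0")
    case True
    then show ?thesis using linear_0[OF bounded_linear.linear[OF lin[OF i]]] by simp
  next
    case False
    interpret bounded_linear "F i" using lin[OF i] .
    \<comment> \<open>This puts \<open>a + c *\<^sub>R x\<close> at distance \<open>e / 2\<close>
      from the centre \<open>a\<close>. Both endpoints have values of norm at most \<open>n\<close>,
      so \<open>c * norm (F i x) \<le> 2 * n\<close>, which is the constant
      \<open>4 * n / e\<close>.\<close>
    define c where "c = e / (2 * norm x)"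
    have c: "c > 0" using False e by (simp add: c_def)
    have "a + c *\<^sub>R x \<in> ball a e \<inter> S"
      using False e aS x S(1) c
      by (auto simp: dist_norm c_def subspace_add subspace_scale)
    then have "a + c *\<^sub>R x \<in> L n" using e(2) U(3) by blast
    then have "norm (F i (a + c *\<^sub>R x)) \<le> n" using i by (simp add: L_def)
    moreover have "norm (F i a) \<le> n" using U i by (auto simp: L_def)
    moreover have "F i (c *\<^sub>R x) = F i (a + c *\<^sub>R x) - F i a" by (simp add: add)
    ultimately have "norm (F i (c *\<^sub>R x)) \<le> 2 * n"
      using norm_triangle_ineq4[of "F i (a + c *\<^sub>R x)" "F i a"] by simp
    then have "c * norm (F i x) \<le> 2 * n" using c by (simp add: scaleR)
    then show ?thesis using False e by (simp add: c_def field_simps)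
  qed
  then show thesis by (rule that)
qed

lemma linear_on_subspaceD:
  assumes "linear_on_subspace W E"
  shows "subspace W" "u \<in> W \<Longrightarrow> v \<in> W \<Longrightarrow> E (u + v) = E u + E v"
    "u \<in> W \<Longrightarrow> E (c *\<^sub>R u) = c *\<^sub>R E u" "E 0 = 0"
    "u \<in> W \<Longrightarrow> v \<in> W \<Longrightarrow> E (u - v) = E u - E v"
proof -
  show add: "E (u + v) = E u + E v" if "u \<in> W" "v \<in> W" for u v
    using assms that by (auto simp: linear_on_subspace_def)
  show W: "subspace W" using assms by (auto simp: linear_on_subspace_def)
  show sc: "E (c *\<^sub>R u) = c *\<^sub>R E u" if "u \<in> W" for c u
    using assms that by (auto simp: linear_on_subspace_def)
  show "E 0 = 0" using sc[OF subspace_0[OF W], of 0] by simp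
  show "E (u - v) = E u - E v" if "u \<in> W" "v \<in> W"
    using add[of u "(-1) *\<^sub>R v"] sc[of v "-1"] that subspace_scale[OF W, of v "-1"] by simp
qed

lemma subspace_closure:
  fixes S :: "'a::real_normed_vector set"
  assumes "subspace S"
  shows "subspace (closure S)"
  unfolding subspace_def
proof (intro conjI ballI allI)
  show "0 \<in> closure S" using subspace_0[OF assms] closure_subset by blast
next
  fix x y assume "x \<in> closure S" "y \<in> closure S"
  then obtain s t where "\<And>n. s n \<in> S" "s \<longlonglongrightarrow> x" "\<And>n. t n \<in> S" "t \<longlonglongrightarrow> y"
    unfolding closure_sequential by metis
  then have "\<And>n. s n + t n \<in> S" "(\<lambda>n. s n + t n) \<longlonglongrightarrow> x + y"
    using assms by (auto simp: subspace_add intro: tendsto_add)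
  then show "x + y \<in> closure S"
    unfolding closure_sequential by (intro exI[of _ "\<lambda>n. s n + t n"]) auto
next
  fix c x assume "x \<in> closure S"
  then obtain s where "\<And>n. s n \<in> S" "s \<longlonglongrightarrow> x"
    unfolding closure_sequential by metis
  then have "\<And>n. c *\<^sub>R s n \<in> S" "(\<lambda>n. c *\<^sub>R s n) \<longlonglongrightarrow> c *\<^sub>R x"
    using assms by (auto simp: subspace_scale intro: tendsto_scaleR)
  then show "c *\<^sub>R x \<in> closure S"
    unfolding closure_sequential by (intro exI[of _ "\<lambda>n. c *\<^sub>R s n"]) auto
qed

text \<open>The bound gives uniform continuity and completeness of the target gives the extension;
  linearity and the same \<open>K\<close> pass to limits of sequences from \<open>S\<close>. It is
  used both for integrals that lie only in a closure and to produce the functional behind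
  \<open>adj\<close>.\<close>

lemma extend_to_closure:
  fixes F :: "'a::real_normed_vector \<Rightarrow> 'b::{real_normed_vector, complete_space}"
  assumes F: "linear_on_subspace S F" and K: "\<And>x. x \<in> S \<Longrightarrow> norm (F x) \<le> K * norm x"
  obtains G where "linear_on_subspace (closure S) G" "\<And>x. x \<in> S \<Longrightarrow> G x = F x"
    "\<And>x. x \<in> closure S \<Longrightarrow> norm (G x) \<le> K * norm x"
proof -
  note D = linear_on_subspaceD[OF F]
  \<comment> \<open>\<open>K\<close> may be zero or negative; \<open>M\<close> is positive, so
    \<open>e / M\<close> is a legitimate modulus of continuity.\<close>
  define M where "M = \<bar>K\<bar> + 1"
  have M: "norm (F x) \<le> M * norm x" if "x \<in> S" for x
    using K[OF that] by (rule order_trans) (auto simp: M_def intro: mult_right_mono)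
  have "uniformly_continuous_on S F"
  unfolding uniformly_continuous_on_def
  proof (intro allI impI)
    fix e :: real assume e: "e > 0"
    have "dist (F y) (F x) < e" if xy: "x \<in> S" "y \<in> S" "dist y x < e / M" for x y
    proof -
      have "dist (F y) (F x) = norm (F (y - x))" using D(5) xy by (simp add: dist_norm)
      also have "\<dots> \<le> M * norm (y - x)" using M xy D(1) by (simp add: subspace_diff)
      also have "\<dots> < e" using xy(3) by (simp add: M_def dist_norm field_simps)
      finally show ?thesis .
    qed
    moreover have "e / M > 0" using e by (simp add: M_def)
    ultimately show "\<exists>d>0. \<forall>x\<in>S. \<forall>y\<in>S. dist y x < d \<longrightarrow> dist (F y) (F x) < e"
      by blast
  qed
  then obtain G where G: "uniformly_continuous_on (closure S) G" "\<And>x. x \<in> S \<Longrightarrow> F x = G x"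
    using uniformly_continuous_on_extension_on_closure by metis
  have sub: "subspace (closure S)" using D(1) by (rule subspace_closure)
  have lim: "(\<lambda>n. F (s n)) \<longlonglongrightarrow> G x" if "\<And>n. s n \<in> S" "s \<longlonglongrightarrow> x" for s x
  proof -
    have "(\<lambda>n. G (s n)) \<longlonglongrightarrow> G x"
    proof (rule continuous_on_tendsto_compose[OF uniformly_continuous_imp_continuous[OF G(1)] that(2)])
      show "x \<in> closure S" using that closure_sequential by blast
      show "\<forall>\<^sub>F n in sequentially. s n \<in> closure S" using closure_subset[of S] that(1) by (intro always_eventually) auto
    qed
    then show ?thesis using G(2) that(1) by simp
  qed
  show thesis
  proof (rule that)
    show "linear_on_subspace (closure S) G"
      unfolding linear_on_subspace_def
    proof (intro conjI ballI allI sub)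
      fix u v assume "u \<in> closure S" "v \<in> closure S"
      then obtain s t where s: "\<And>n. s n \<in> S" "s \<longlonglongrightarrow> u" and t: "\<And>n. t n \<in> S" "t \<longlonglongrightarrow> v"
        unfolding closure_sequential by metis
      have "(\<lambda>n. F (s n + t n)) \<longlonglongrightarrow> G (u + v)"
        using s t D(1) by (intro lim tendsto_add) (auto simp: subspace_add)
      moreover have "(\<lambda>n. F (s n + t n)) \<longlonglongrightarrow> G u + G v"
        using tendsto_add[OF lim[OF s] lim[OF t]] s t D(2) by simp
      ultimately show "G (u + v) = G u + G v" by (rule LIMSEQ_unique)
    next
      fix c u assume "u \<in> closure S"
      then obtain s where s: "\<And>n. s n \<in> S" "s \<longlonglongrightarrow> u" 
        unfolding closure_sequential by metis
      have "(\<lambda>n. F (c *\<^sub>R s n)) \<longlonglongrightarrow> G (c *\<^sub>R u)"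
        using s D(1) by (intro lim tendsto_scaleR tendsto_const) (auto simp: subspace_scale)
      moreover have "(\<lambda>n. F (c *\<^sub>R s n)) \<longlonglongrightarrow> c *\<^sub>R G u"
        using tendsto_scaleR[OF tendsto_const lim[OF s]] s D(3) by simp
      ultimately show "G (c *\<^sub>R u) = c *\<^sub>R G u" by (rule LIMSEQ_unique)
    qed
    show "G x = F x" if "x \<in> S" for x using G(2) that by simp
    fix x assume "x \<in> closure S"
    then obtain s where s: "\<And>n. s n \<in> S" "s \<longlonglongrightarrow> x" 
      unfolding closure_sequential by metis
    have "(\<lambda>n. K * norm (s n)) \<longlonglongrightarrow> K * norm x"
      using s(2) by (intro tendsto_intros)
    then show "norm (G x) \<le> K * norm x"
      by (rule tendsto_le[OF sequentially_bot _ tendsto_norm[OF lim[OF s]]]) (use K s(1) in auto)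
  qed
qed

section \<open>Sobolev functions under bounded linear maps\<close>

lemma linear_on_subspace_sum:
  assumes "linear_on_subspace Y F" "finite I" "\<And>i. i \<in> I \<Longrightarrow> f i \<in> Y"
  shows "F (\<Sum>i\<in>I. f i) = (\<Sum>i\<in>I. F (f i))"
  using assms(2,3)
proof (induction I)
  case empty
  then show ?case using linear_on_subspaceD(4)[OF assms(1)] by simp
next
  case (insert i I)
  then have "(\<Sum>i\<in>I. f i) \<in> Y"
    using linear_on_subspaceD(1)[OF assms(1)] by (auto intro: subspace_sum)
  with insert show ?case using linear_on_subspaceD(2)[OF assms(1)] by simp
qed

text \<open>The tags lie in the interval, so every Riemann sum is a linear combination of elements
  of \<open>Y\<close>, and the integral is a limit of such sums.\<close>

lemma has_integral_closed_subspace: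
  fixes k :: "real \<Rightarrow> 'b::real_normed_vector"
  assumes Y: "subspace Y" "closed Y" and k: "k ` {a..b} \<subseteq> Y" and A: "(k has_integral A) {a..b}"
  shows "A \<in> Y"
proof -
  have mem: "measure lborel I *\<^sub>R k x \<in> Y" if "p tagged_division_of {a..b}" "(x, I) \<in> p" for p x I
    using tagged_division_ofD(2,3)[OF that] k by (intro subspace_scale[OF Y(1)]) auto
  have "A \<in> closure Y"
    unfolding closure_approachable
  proof (intro allI impI)
    fix e :: real assume "e > 0"
    then obtain \<gamma> where "gauge \<gamma>" and \<gamma>: "\<And>p. p tagged_division_of {a..b} \<Longrightarrow> \<gamma> fine p \<Longrightarrow>
        norm ((\<Sum>(x, I)\<in>p. measure lborel I *\<^sub>R k x) - A) < e"
      using A unfolding has_integral_real by meson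
    moreover obtain p where "p tagged_division_of {a..b}" "\<gamma> fine p"
      using fine_division_exists_real \<open>gauge \<gamma>\<close> by blast
    moreover have "(\<Sum>(x, I)\<in>p. measure lborel I *\<^sub>R k x) \<in> Y"
      using mem[OF \<open>p tagged_division_of {a..b}\<close>] Y(1) by (auto intro!: subspace_sum)
    ultimately show "\<exists>y\<in>Y. dist y A < e"
      by (auto simp: dist_norm)
  qed
  then show ?thesis using Y(2) by simp
qed

text \<open>Riemann sums commute with \<open>F\<close>, so no bounded linear extension of \<open>F\<close> to the ambient space is
  needed.\<close>

lemma has_integral_linear_on_subspace:
  fixes k :: "real \<Rightarrow> 'b::real_normed_vector" and F :: "'b \<Rightarrow> 'c::real_normed_vector"
  assumes F: "linear_on_subspace Y F" and K: "\<And>y. y \<in> Y \<Longrightarrow> norm (F y) \<le> K * norm y"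
    and Y: "closed Y" and k: "k ` {a..b} \<subseteq> Y" and A: "(k has_integral A) {a..b}"
  shows "((\<lambda>t. F (k t)) has_integral F A) {a..b}"
proof -
  note D = linear_on_subspaceD[OF F]
  have mem: "measure lborel I *\<^sub>R k x \<in> Y" if "p tagged_division_of {a..b}" "(x, I) \<in> p" for p x I
    using tagged_division_ofD(2,3)[OF that] k by (intro subspace_scale[OF D(1)]) auto
  have sum_mem: "(\<Sum>(x, I)\<in>p. measure lborel I *\<^sub>R k x) \<in> Y" if "p tagged_division_of {a..b}" for p
    using mem[OF that] D(1) by (auto intro!: subspace_sum)
  have AY: "A \<in> Y" using has_integral_closed_subspace[OF D(1) Y k A] .
  show ?thesis
    unfolding has_integral_real
  proof (intro allI impI)
    fix e :: real assume "e > 0"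
    define M where "M = \<bar>K\<bar> + 1"
    have M: "norm (F y) \<le> M * norm y" if "y \<in> Y" for y
      using K[OF that] by (rule order_trans) (auto simp: M_def intro: mult_right_mono)
    have M0: "M > 0" by (simp add: M_def)
    then have "e / M > 0" using \<open>e > 0\<close> by simp
    then obtain \<gamma> where "gauge \<gamma>" and \<gamma>: "\<And>p. p tagged_division_of {a..b} \<Longrightarrow> \<gamma> fine p \<Longrightarrow>
        norm ((\<Sum>(x, I)\<in>p. measure lborel I *\<^sub>R k x) - A) < e / M"
      using A unfolding has_integral_real by meson
    have "norm ((\<Sum>(x, I)\<in>p. measure lborel I *\<^sub>R F (k x)) - F A) < e"
      if p: "p tagged_division_of {a..b}" "\<gamma> fine p" for p
    proof -
      have "F (\<Sum>z\<in>p. measure lborel (snd z) *\<^sub>R k (fst z)) = (\<Sum>z\<in>p. F (measure lborel (snd z) *\<^sub>R k (fst z)))"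
        using mem[OF p(1)] p(1) by (intro linear_on_subspace_sum[OF F]) auto
      also have "\<dots> = (\<Sum>z\<in>p. measure lborel (snd z) *\<^sub>R F (k (fst z)))"
        using tagged_division_ofD(2,3)[OF p(1)] k by (intro sum.cong D(3)) fastforce+
      finally have "(\<Sum>(x, I)\<in>p. measure lborel I *\<^sub>R F (k x)) - F A
          = F ((\<Sum>(x, I)\<in>p. measure lborel I *\<^sub>R k x) - A)"
        using sum_mem[OF p(1)] AY D(5) by (simp add: case_prod_unfold)
      also have "norm \<dots> \<le> M * norm ((\<Sum>(x, I)\<in>p. measure lborel I *\<^sub>R k x) - A)"
        using sum_mem[OF p(1)] AY D(1) by (intro M subspace_diff)
      also have "\<dots> < M * (e / M)" using \<gamma>[OF p] M0 by (intro mult_strict_left_mono)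
      finally show ?thesis using M0 by simp
    qed
    with \<open>gauge \<gamma>\<close> show "\<exists>\<gamma>. gauge \<gamma> \<and> (\<forall>p. p tagged_division_of {a..b} \<and> \<gamma> fine p \<longrightarrow>
        norm ((\<Sum>(x, I)\<in>p. measure lborel I *\<^sub>R F (k x)) - F A) < e)"
      by (intro exI[of _ \<gamma>] conjI allI impI) auto
  qed
qed

lemma tendsto_linear_on_subspace:
  assumes F: "linear_on_subspace Y F" and K: "\<And>y. y \<in> Y \<Longrightarrow> norm (F y) \<le> K * norm y"
    and l: "l \<in> Y" and s: "\<forall>\<^sub>F x in N. s x \<in> Y" and lim: "(s \<longlongrightarrow> l) N"
  shows "((\<lambda>x. F (s x)) \<longlongrightarrow> F l) N"
proof (rule Lim_transform_bound[THEN Lim_null[THEN iffD2], rotated])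
  show "((\<lambda>x. K * norm (s x - l)) \<longlongrightarrow> 0) N"
    using lim by (intro tendsto_mult_right_zero tendsto_norm_zero) (simp flip: Lim_null)
  show "\<forall>\<^sub>F x in N. norm (F (s x) - F l) \<le> norm (K * norm (s x - l))"
    using s
  proof eventually_elim
    case (elim x)
    then have "norm (F (s x) - F l) \<le> K * norm (s x - l)"
      using K[of "s x - l"] l linear_on_subspaceD(1,5)[OF F] by (simp add: subspace_diff)
    then show ?case by simp
  qed
qed

text \<open>\<open>F\<close> is controlled only on \<open>Y\<close>, so the approximating simple
  functions must themselves take values there; this is what the range condition in
  \<open>strongly_measurable_in\<close> provides.\<close>

lemma strongly_measurable_linear_on_subspace:
  assumes F: "linear_on_subspace Y F" and K: "\<And>y. y \<in> Y \<Longrightarrow> norm (F y) \<le> K * norm y"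
    and u: "u ` I \<subseteq> Y" "strongly_measurable_in I Y u"
  shows "strongly_measurable_in I UNIV (\<lambda>t. F (u t))"
proof -
  obtain s where s: "\<And>n. simple_function (lebesgue_on I) (s n)" "\<And>n. s n ` I \<subseteq> Y"
    "AE t in lebesgue_on I. (\<lambda>n. s n t) \<longlonglongrightarrow> u t"
    using u(2) unfolding strongly_measurable_in_def by blast
  have "AE t in lebesgue_on I. (\<lambda>n. F (s n t)) \<longlonglongrightarrow> F (u t)"
    using s(3) AE_space
  proof eventually_elim
    case (elim t)
    then have "t \<in> I" by (simp add: space_restrict_space)
    with elim show ?case
      using u(1) s(2) by (intro tendsto_linear_on_subspace[OF F K]) (auto intro!: always_eventually)
  qed
  then show ?thesis
    unfolding strongly_measurable_in_def
    by (intro exI[of _ "\<lambda>n t. F (s n t)"]) (auto intro: simple_function_compose1 s(1))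
qed

lemma Linfty_linear_on_subspace:
  assumes F: "linear_on_subspace Y F" and K: "\<And>y. y \<in> Y \<Longrightarrow> norm (F y) \<le> K * norm y"
    and u: "u \<in> Linfty I Y"
  shows "(\<lambda>t. F (u t)) \<in> Linfty I UNIV"
proof -
  obtain M where M: "AE t in lebesgue_on I. norm (u t) \<le> M" using u by (auto simp: Linfty_def)
  have "AE t in lebesgue_on I. norm (F (u t)) \<le> \<bar>K\<bar> * M"
    using M AE_space
  proof eventually_elim
    case (elim t)
    then have "u t \<in> Y" using u by (auto simp: Linfty_def space_restrict_space)
    then have "norm (F (u t)) \<le> K * norm (u t)" by (rule K)
    also have "\<dots> \<le> \<bar>K\<bar> * M" using elim by (intro mult_mono) auto
    finally show ?case .
  qed
  then show ?thesis
    using u strongly_measurable_linear_on_subspace[OF F K] by (auto simp: Linfty_def)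
qed

text \<open>The weak derivative of \<open>F\<close> composed with \<open>h\<close> is
  \<open>F\<close> composed with \<open>u\<close>, because \<open>F\<close> passes through both
  integrals of the defining identity. The functions have values in \<open>Y\<close>, but their
  integrals are only known to lie in \<open>closure Y\<close>, so the integrals are taken to the
  extension \<open>G\<close>.\<close>

lemma W1infty_linear_on_subspace:
  fixes F :: "'b::real_normed_vector \<Rightarrow> 'c::{real_normed_vector, complete_space}"
  assumes F: "linear_on_subspace Y F" and K: "\<And>y. y \<in> Y \<Longrightarrow> norm (F y) \<le> K * norm y"
    and h: "h \<in> W1infty a b Y"
  shows "(\<lambda>t. F (h t)) \<in> W1infty a b UNIV"
proof -
  have hY: "h ` {a..b} \<subseteq> Y" and "continuous_on {a..b} h" and hL: "h \<in> Linfty {a..b} Y"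
    using h by (auto simp: W1infty_def Linfty_def)
  obtain u where u: "u \<in> Linfty {a..b} Y" "weak_derivative a b h u"
    using h by (auto simp: W1infty_def)
  have uY: "u ` {a..b} \<subseteq> Y" using u by (auto simp: Linfty_def)
  obtain G where G: "linear_on_subspace (closure Y) G" "\<And>x. x \<in> Y \<Longrightarrow> G x = F x"
    "\<And>x. x \<in> closure Y \<Longrightarrow> norm (G x) \<le> K * norm x"
    using extend_to_closure[OF F K] by metis
  have sub: "subspace Y" using F by (rule linear_on_subspaceD)
  have mem: "\<phi> t *\<^sub>R k t \<in> closure Y" if "k ` {a..b} \<subseteq> Y" "t \<in> {a..b}"
    for \<phi> :: "real \<Rightarrow> real" and k t
  proof -
    have "k t \<in> closure Y" using that closure_subset by blast
    then show ?thesis using linear_on_subspaceD(1)[OF G(1)] by (simp add: subspace_scale)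
  qed
  have mem_closure: "A \<in> closure Y" if "((\<lambda>t. \<phi> t *\<^sub>R h t) has_integral A) {a..b}" for \<phi> A
    using mem[OF hY] by (intro has_integral_closed_subspace[OF _ _ _ that] subspace_closure[OF sub]) auto
  have int: "((\<lambda>t. \<phi> t *\<^sub>R F (k t)) has_integral G A) {a..b}"
    if k: "k ` {a..b} \<subseteq> Y" and A: "((\<lambda>t. \<phi> t *\<^sub>R k t) has_integral A) {a..b}"
    for \<phi> k A
  proof -
    have "(\<lambda>t. \<phi> t *\<^sub>R k t) ` {a..b} \<subseteq> closure Y" using mem[OF k] by blast
    then have "((\<lambda>t. G (\<phi> t *\<^sub>R k t)) has_integral G A) {a..b}"
      using has_integral_linear_on_subspace[OF G(1,3) closed_closure _ A] by blast
    then show ?thesis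
    proof (rule has_integral_eq[rotated])
      fix t assume t: "t \<in> {a..b}"
      then have "k t \<in> Y" using k by auto
      then show "G (\<phi> t *\<^sub>R k t) = \<phi> t *\<^sub>R F (k t)"
        using G(2) linear_on_subspaceD(3)[OF F] sub by (simp add: subspace_scale)
    qed
  qed
  have "weak_derivative a b (\<lambda>t. F (h t)) (\<lambda>t. F (u t))"
    unfolding weak_derivative_def
  proof
    fix \<phi> assume "\<phi> \<in> test_functions a b"
    then obtain A where A: "((\<lambda>t. deriv \<phi> t *\<^sub>R h t) has_integral A) {a..b}"
      "((\<lambda>t. \<phi> t *\<^sub>R u t) has_integral (- A)) {a..b}"
      using u(2) unfolding weak_derivative_def by blast
    \<comment> \<open>\<open>G\<close> is linear on \<open>closure Y\<close> only, so the sign can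
      be pulled out once \<open>A\<close> is known to lie there.\<close>
    have "G (- A) = - G A"
      using linear_on_subspaceD(3)[OF G(1) mem_closure[OF A(1)], of "-1"] by simp
    then show "\<exists>A. ((\<lambda>t. deriv \<phi> t *\<^sub>R F (h t)) has_integral A) {a..b} \<and>
       ((\<lambda>t. \<phi> t *\<^sub>R F (u t)) has_integral (- A)) {a..b}"
      using int[OF hY A(1)] int[OF uY A(2)] by auto
  qed
  moreover have "continuous_on {a..b} (\<lambda>t. F (h t))"
    unfolding continuous_on_def
  proof
    fix t assume t: "t \<in> {a..b}"
    have "\<forall>\<^sub>F s in at t within {a..b}. h s \<in> Y" 
      using hY by (auto simp: eventually_at_filter intro!: always_eventually)
    then show "((\<lambda>t. F (h t)) \<longlongrightarrow> F (h t)) (at t within {a..b})"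
      using hY t \<open>continuous_on {a..b} h\<close>
      by (intro tendsto_linear_on_subspace[OF F K]) (auto simp: continuous_on_def)
  qed
  ultimately show ?thesis
    using Linfty_linear_on_subspace[OF F K] u(1) hL unfolding W1infty_def by auto
qed

lemma W1infty_bounded_linear:
  fixes F :: "'b::real_normed_vector \<Rightarrow> 'c::{real_normed_vector, complete_space}"
  assumes "bounded_linear F" "h \<in> W1infty a b UNIV"
  shows "(\<lambda>t. F (h t)) \<in> W1infty a b UNIV"
proof -
  interpret F: bounded_linear F by fact
  have "linear_on_subspace UNIV F" by (simp add: linear_on_subspace_def F.add F.scaleR)
  moreover obtain K where "\<And>x. norm (F x) \<le> norm x * K" using F.bounded by blast
  then have "\<And>x. norm (F x) \<le> K * norm x" by (simp add: mult.commute)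
  ultimately show ?thesis by (rule W1infty_linear_on_subspace[OF _ _ assms(2)])
qed

lemma Linfty_add:
  assumes u: "u \<in> Linfty I UNIV" and v: "v \<in> Linfty I UNIV"
  shows "(\<lambda>t. u t + v t) \<in> Linfty I UNIV"
proof -
  obtain s where s: "\<And>n. simple_function (lebesgue_on I) (s n)"
    "AE t in lebesgue_on I. (\<lambda>n. s n t) \<longlonglongrightarrow> u t"
    using u by (auto simp: Linfty_def strongly_measurable_in_def)
  obtain r where r: "\<And>n. simple_function (lebesgue_on I) (r n)"
    "AE t in lebesgue_on I. (\<lambda>n. r n t) \<longlonglongrightarrow> v t"
    using v by (auto simp: Linfty_def strongly_measurable_in_def)
  have "AE t in lebesgue_on I. (\<lambda>n. s n t + r n t) \<longlonglongrightarrow> u t + v t"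
    using s(2) r(2) by eventually_elim (rule tendsto_add)
  then have "strongly_measurable_in I UNIV (\<lambda>t. u t + v t)"
    unfolding strongly_measurable_in_def
    by (intro exI[of _ "\<lambda>n t. s n t + r n t"]) (auto intro: simple_function_compose2 s(1) r(1))
  moreover obtain K L where "AE t in lebesgue_on I. norm (u t) \<le> K" "AE t in lebesgue_on I. norm (v t) \<le> L"
    using u v by (auto simp: Linfty_def)
  then have "AE t in lebesgue_on I. norm (u t + v t) \<le> K + L"
    by eventually_elim (rule norm_triangle_mono)
  ultimately show ?thesis by (auto simp: Linfty_def)
qed

lemma W1infty_add:
  assumes h: "h \<in> W1infty a b UNIV" and k: "k \<in> W1infty a b UNIV"
  shows "(\<lambda>t. h t + k t) \<in> W1infty a b UNIV"
proof -
  obtain u v where u: "u \<in> Linfty {a..b} UNIV" "weak_derivative a b h u"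
    and v: "v \<in> Linfty {a..b} UNIV" "weak_derivative a b k v"
    using h k by (auto simp: W1infty_def)
  have "weak_derivative a b (\<lambda>t. h t + k t) (\<lambda>t. u t + v t)"
    unfolding weak_derivative_def
  proof
    fix \<phi> assume "\<phi> \<in> test_functions a b"
    then obtain A B where A: "((\<lambda>t. deriv \<phi> t *\<^sub>R h t) has_integral A) {a..b}"
      "((\<lambda>t. \<phi> t *\<^sub>R u t) has_integral (- A)) {a..b}"
      and B: "((\<lambda>t. deriv \<phi> t *\<^sub>R k t) has_integral B) {a..b}"
      "((\<lambda>t. \<phi> t *\<^sub>R v t) has_integral (- B)) {a..b}"
      using u(2) v(2) unfolding weak_derivative_def by meson
    show "\<exists>A. ((\<lambda>t. deriv \<phi> t *\<^sub>R (h t + k t)) has_integral A) {a..b} \<and>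
       ((\<lambda>t. \<phi> t *\<^sub>R (u t + v t)) has_integral (- A)) {a..b}"
      using has_integral_add[OF A(1) B(1)] has_integral_add[OF A(2) B(2)]
      by (intro exI[of _ "A + B"]) (simp add: scaleR_add_right)
  qed
  then show ?thesis
    using h k Linfty_add u(1) v(1) unfolding W1infty_def by (auto intro: continuous_on_add)
qed

lemma Linfty_cong:
  fixes u v :: "real \<Rightarrow> 'a::real_normed_vector"
  assumes "\<And>t. t \<in> I \<Longrightarrow> u t = v t" "u \<in> Linfty I Y"
  shows "v \<in> Linfty I Y"
proof -
  have "(AE t in lebesgue_on I. (\<lambda>n. s n t) \<longlonglongrightarrow> u t) = (AE t in lebesgue_on I. (\<lambda>n. s n t) \<longlonglongrightarrow> v t)"
    for s :: "nat \<Rightarrow> real \<Rightarrow> 'a"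
    using assms(1) by (intro AE_cong) (auto simp: space_restrict_space)
  moreover have "(AE t in lebesgue_on I. norm (u t) \<le> K) = (AE t in lebesgue_on I. norm (v t) \<le> K)" for K
    using assms(1) by (intro AE_cong) (auto simp: space_restrict_space)
  moreover have "u ` I = v ` I" using assms(1) by (intro image_cong) auto
  ultimately show ?thesis
    using assms(2) unfolding Linfty_def strongly_measurable_in_def by simp
qed

text \<open>The inclusion fixes a stress on \<open>{0..T}\<close> only and leaves it arbitrary
  elsewhere, so regularity has to be insensitive to values off the interval.\<close>

lemma W1infty_cong:
  assumes eq: "\<And>t. t \<in> {a..b} \<Longrightarrow> h t = k t" and h: "h \<in> W1infty a b Y"
  shows "k \<in> W1infty a b Y"
proof -
  have "((\<lambda>t. \<phi> t *\<^sub>R h t) has_integral A) {a..b} = ((\<lambda>t. \<phi> t *\<^sub>R k t) has_integral A) {a..b}" for \<phi> A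
    using eq by (intro has_integral_cong) auto
  then have "weak_derivative a b h = weak_derivative a b k"
    by (simp add: weak_derivative_def fun_eq_iff)
  moreover have "continuous_on {a..b} h = continuous_on {a..b} k"
    using eq by (intro continuous_on_cong) auto
  moreover have "k \<in> Linfty {a..b} Y"
    using h by (intro Linfty_cong[OF eq]) (auto simp: W1infty_def)
  ultimately show ?thesis
    using h unfolding W1infty_def by auto
qed

section \<open>The operators of elasticity\<close>

lemma bounded_symmetric_coerciveE:
  assumes "bounded_symmetric_coercive C"
  obtains c0 where "bounded_linear C" "\<And>\<sigma> \<tau>. C \<sigma> \<bullet> \<tau> = \<sigma> \<bullet> C \<tau>"
    "c0 > 0" "\<And>\<tau>. C \<tau> \<bullet> \<tau> \<ge> c0 * (norm \<tau>)\<^sup>2"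
  using assms unfolding bounded_symmetric_coercive_def by blast

text \<open>The minimiser over \<open>R\<close> of the energy \<open>e \<mapsto> C e \<bullet> e - 2 (\<tau> \<bullet> e)\<close>; a minimising sequence is Cauchy
  by the parallelogram identity.\<close>

lemma coercive_variational_solution:
  fixes C :: "'h::{real_inner, complete_space} \<Rightarrow> 'h"
  assumes C: "bounded_symmetric_coercive C" and R: "subspace R" "closed R"
  shows "\<exists>e\<in>R. \<forall>r\<in>R. C e \<bullet> r = \<tau> \<bullet> r"
proof -
  obtain c0 where bl: "bounded_linear C" and sym: "\<And>\<sigma> \<tau>. C \<sigma> \<bullet> \<tau> = \<sigma> \<bullet> C \<tau>"
    and c0: "c0 > 0" and coer: "\<And>\<tau>. C \<tau> \<bullet> \<tau> \<ge> c0 * (norm \<tau>)\<^sup>2"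
    using bounded_symmetric_coerciveE[OF C] by metis
  interpret C: bounded_linear C by (rule bl)
  define E where "E e = C e \<bullet> e - 2 * (\<tau> \<bullet> e)" for e
  \<comment> \<open>Completing the square in \<open>norm e\<close>, with coercivity controlling the
    quadratic term, keeps the infimum \<open>m\<close> finite.\<close>
  have lower: "E e \<ge> - ((norm \<tau>)\<^sup>2 / c0)" for e
  proof -
    have "\<tau> \<bullet> e \<le> norm \<tau> * norm e" by (rule norm_cauchy_schwarz)
    moreover have "0 \<le> (norm \<tau> / sqrt c0 - sqrt c0 * norm e)\<^sup>2" by simp
    then have "0 \<le> (norm \<tau>)\<^sup>2 / c0 - 2 * (norm \<tau> * norm e) + c0 * (norm e)\<^sup>2"
      using c0 by (simp add: power2_diff power_divide power_mult_distrib)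
    ultimately show ?thesis using coer[of e] by (simp add: E_def)
  qed
  define m where "m = Inf (E ` R)"
  have bb: "bdd_below (E ` R)" using lower by (auto intro!: bdd_belowI)
  have ne: "R \<noteq> {}" using subspace_0[OF R(1)] by auto
  have m: "m \<le> E e" if "e \<in> R" for e
    unfolding m_def using bb that by (auto intro: cInf_lower)
  have "\<exists>e\<in>R. E e < m + d" if "d > 0" for d
    using cInf_lessD[of "E ` R" "m + d"] ne that unfolding m_def by auto
  then have "\<exists>e\<in>R. E e < m + 1 / Suc n" for n :: nat by simp
  then obtain s where s: "\<And>n. s n \<in> R" "\<And>n::nat. E (s n) < m + 1 / Suc n" by metis
  have par: "c0 / 2 * (norm (a - b))\<^sup>2 \<le> E a + E b - 2 * m" if "a \<in> R" "b \<in> R" for a b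
  proof -
    have "(1/2) *\<^sub>R (a + b) \<in> R" using R(1) that by (simp add: subspace_add subspace_scale)
    note m[OF this]
    moreover have "E a + E b - 2 * E ((1/2) *\<^sub>R (a + b)) = (C (a - b) \<bullet> (a - b)) / 2"
    proof -
      have "C b \<bullet> a = C a \<bullet> b" by (metis sym inner_commute)
      then show ?thesis
        by (simp add: E_def C.scaleR C.add C.diff inner_add inner_diff algebra_simps)
    qed
    moreover note coer[of "a - b"]
    ultimately show ?thesis by simp
  qed
  have "Cauchy s"
  proof (rule CauchyI)
    fix e :: real assume e: "e > 0"
    \<comment> \<open>Beyond index \<open>N\<close> two members of the sequence exceed twice the
      infimum by less than \<open>2 / Suc N\<close> in total; by \<open>par\<close> their distance
      is below \<open>e\<close> once this is at most \<open>c0 / 2 * e\<^sup>2\<close>.\<close>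
    obtain N :: nat where "4 / (c0 * e\<^sup>2) < N" using reals_Archimedean2 by blast
    then have N: "4 / (c0 * e\<^sup>2) < Suc N" by simp
    have "norm (s p - s q) < e" if "p \<ge> N" "q \<ge> N" for p q
    proof -
      have le: "1 / real (Suc p) \<le> 1 / Suc N" "1 / real (Suc q) \<le> 1 / Suc N"
        using that by (auto simp: field_simps)
      have "c0 / 2 * (norm (s p - s q))\<^sup>2 < 2 * (1 / Suc N)"
        using par[OF s(1) s(1), of p q] s(2)[of p] s(2)[of q] le by linarith
      also have "\<dots> < c0 / 2 * e\<^sup>2" using N c0 e by (simp add: field_simps)
      finally have "(norm (s p - s q))\<^sup>2 < e\<^sup>2" using c0 by simp
      then show ?thesis using e by (simp add: power_less_imp_less_base)
    qed
    then show "\<exists>M. \<forall>m\<ge>M. \<forall>n\<ge>M. norm (s m - s n) < e" by blast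
  qed
  then obtain e where e: "s \<longlonglongrightarrow> e" using Cauchy_convergent convergent_def by blast
  have eR: "e \<in> R" using R(2) s(1) e closed_sequentially by blast
  have "(\<lambda>n. E (s n)) \<longlonglongrightarrow> E e"
    unfolding E_def by (intro tendsto_intros C.tendsto e)
  moreover have "(\<lambda>n. m + 1 / Suc n) \<longlonglongrightarrow> m + 0"
    by (intro tendsto_intros LIMSEQ_inverse_real_of_nat[unfolded inverse_eq_divide])
  ultimately have Em: "E e \<le> m + 0"
    by (rule LIMSEQ_le) (use s(2) less_imp_le in blast)
  have "C e \<bullet> r = \<tau> \<bullet> r" if r: "r \<in> R" for r
  proof -
    define b where "b = C e \<bullet> r - \<tau> \<bullet> r"
    define a where "a = C r \<bullet> r"
    \<comment> \<open>Increment of the energy from the minimiser \<open>e\<close> in the direction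
      \<open>r\<close>. A nonnegative quadratic that vanishes at 0 has no linear term, so
      \<open>b = 0\<close>.\<close>
    have quad: "0 \<le> x\<^sup>2 * a + 2 * x * b" for x
    proof -
      have "E e \<le> E (e + x *\<^sub>R r)" using m[of "e + x *\<^sub>R r"] Em eR r R(1)
        by (simp add: subspace_add subspace_scale)
      moreover have "E (e + x *\<^sub>R r) = E e + x\<^sup>2 * a + 2 * x * b"
      proof -
        have "C r \<bullet> e = C e \<bullet> r" by (metis sym inner_commute)
        then show ?thesis
          by (simp add: E_def C.scaleR C.add inner_add a_def b_def power2_eq_square algebra_simps)
      qed
      ultimately show ?thesis by simp
    qed
    have a: "a \<ge> 0" using coer[of r] c0 unfolding a_def by (meson less_imp_le mult_nonneg_nonneg order_trans zero_le_power2)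
    have "b = 0"
    proof (rule ccontr)
      assume "b \<noteq> 0"
      then have "b\<^sup>2 > 0" by simp
      \<comment> \<open>At \<open>x = - s * b\<close> the quadratic equals
        \<open>s * b\<^sup>2 * (s * a - 2)\<close>, negative as soon as \<open>s * a < 2\<close>;
        adding 1 in the denominator covers \<open>a = 0\<close>.\<close>
      define s where "s = 1 / (a + 1)"
      have "s > 0" "s * a < 2" using a by (auto simp: s_def field_simps)
      then have "s * b\<^sup>2 * (s * a - 2) < 0" using \<open>b\<^sup>2 > 0\<close> by (intro mult_pos_neg) auto
      moreover have "(- (s * b))\<^sup>2 * a + 2 * (- (s * b)) * b = s * b\<^sup>2 * (s * a - 2)"
        by (simp add: power2_eq_square algebra_simps)
      ultimately show False using quad[of "- (s * b)"] by simp
    qed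
    then show ?thesis by (simp add: b_def)
  qed
  with eR show ?thesis by blast
qed

locale elasticity_operators =
  fixes J :: "'x0::real_normed_vector \<Rightarrow> 'x::real_normed_vector"
    and W :: "'x set"
    and E :: "'x \<Rightarrow> 'h::{real_inner, complete_space}"
    and C :: "'h \<Rightarrow> 'h"
  assumes E: "linear_on_subspace W E"
    and closed_range: "closed (E ` W)"
    and J: "isometry_onto J (closure W)"
    and C: "bounded_symmetric_coercive C"
begin

abbreviation "D \<equiv> adj J W E"
abbreviation "domD \<equiv> dom_adj W E"
abbreviation "R \<equiv> E ` W"
abbreviation "U \<equiv> U_space W E C"
abbreviation "V \<equiv> V_space J W E"
abbreviation "G \<equiv> G_op J W E C"
abbreviation "Q \<equiv> Q_op J W E C"

lemma linear_J: "linear J" and norm_J: "norm (J x) = norm x" and range_J: "range J = closure W"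
  using J by (auto simp: isometry_onto_def)

lemma subspace_R: "subspace R"
  unfolding subspace_def
proof (intro conjI ballI allI)
  note D = linear_on_subspaceD[OF E]
  show "0 \<in> R" using D(4) subspace_0[OF D(1)] by (metis imageI)
  show "x + y \<in> R" if "x \<in> R" "y \<in> R" for x y
    using that D(2) subspace_add[OF D(1)] by (auto simp flip: D(2))
  show "c *\<^sub>R x \<in> R" if "x \<in> R" for c x
    using that subspace_scale[OF D(1)] by (auto simp flip: D(3))
qed

section \<open>Invertibility of the coercive operator\<close>

lemma C_bounded_linear: "bounded_linear C"
  and C_sym: "C \<sigma> \<bullet> \<tau> = \<sigma> \<bullet> C \<tau>"
  using C by (auto simp: bounded_symmetric_coercive_def)

sublocale C: bounded_linear C by (rule C_bounded_linear)

lemma coercive_const: obtains c0 where "c0 > 0" "\<And>\<tau>. c0 * norm \<tau> ^ 2 \<le> C \<tau> \<bullet> \<tau>"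
  using C unfolding bounded_symmetric_coercive_def by blast

lemma coercive_eq_0: "\<tau> = 0" if "C \<tau> \<bullet> \<tau> = 0"
proof -
  obtain c0 where "c0 > 0" and "c0 * norm \<tau> ^ 2 \<le> C \<tau> \<bullet> \<tau>" using coercive_const by blast
  with that show ?thesis by (simp add: mult_le_0_iff)
qed

text \<open>Surjectivity is the variational problem with the whole space in the role of
  \<open>R\<close>; injectivity is coercivity.\<close>

lemma bij_C: "bij C"
proof (rule bijI)
  show "inj C"
  proof (rule injI)
    fix x y assume "C x = C y"
    then have "C (x - y) \<bullet> (x - y) = 0" by (simp add: C.diff)
    then show "x = y" using coercive_eq_0 by fastforce
  qed
  show "surj C"
  proof (rule surjI)
    fix \<tau>
    have "\<exists>e. \<forall>r. C e \<bullet> r = \<tau> \<bullet> r"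
      using coercive_variational_solution[OF C subspace_UNIV closed_UNIV] by simp
    then have "\<exists>e. C e = \<tau>" by (metis vector_eq_rdot)
    then show "C (SOME e. C e = \<tau>) = \<tau>" by (rule someI_ex)
  qed
qed

lemma C_inv [simp]: "C (inv C \<tau>) = \<tau>" "inv C (C \<tau>) = \<tau>"
  using bij_C by (simp_all add: bij_is_surj surj_f_inv_f bij_is_inj)

lemma bounded_linear_inv_C: "bounded_linear (inv C)"
proof -
  obtain c0 where c0: "c0 > 0" and coer: "\<And>\<tau>. c0 * norm \<tau> ^ 2 \<le> C \<tau> \<bullet> \<tau>"
    using coercive_const by blast
  show ?thesis
  proof (rule bounded_linear_intro[where K = "1 / c0"])
    show "inv C (x + y) = inv C x + inv C y" for x y by (metis C_inv C.add)
    show "inv C (r *\<^sub>R x) = r *\<^sub>R inv C x" for r x by (metis C_inv C.scaleR)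
    show "norm (inv C x) \<le> norm x * (1 / c0)" for x
    proof (cases "inv C x = 0")
      case True
      then show ?thesis using c0 by simp
    next
      case False
      have "c0 * norm (inv C x) ^ 2 \<le> x \<bullet> inv C x" using coer[of "inv C x"] by simp
      also have "\<dots> \<le> norm x * norm (inv C x)" by (rule norm_cauchy_schwarz)
      finally show ?thesis using False c0 by (simp add: power2_eq_square field_simps)
    qed
  qed
qed

section \<open>The adjoint as a continuous extension from a dense subspace\<close>

lemma dense_J_vimage: "closure (J -` W) = UNIV"
proof -
  have "x \<in> closure (J -` W)" for x
    unfolding closure_approachable
  proof (intro allI impI)
    fix e :: real assume "e > 0"
    have "J x \<in> closure W" using range_J by auto
    then obtain w where w: "w \<in> W" "dist w (J x) < e"
      using \<open>e > 0\<close> unfolding closure_approachable by blast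
    then obtain y where "w = J y" using range_J closure_subset by blast
    then show "\<exists>y\<in>J -` W. dist y x < e"
      using w by (auto simp: dist_norm linear_diff[OF linear_J, symmetric] norm_J)
  qed
  then show ?thesis by blast
qed

lemma W_eq_J: "u \<in> W \<Longrightarrow> \<exists>x. u = J x"
  using range_J closure_subset by blast

lemma adj_unique:
  assumes "\<And>x. J x \<in> W \<Longrightarrow> blinfun_apply \<phi> x = blinfun_apply \<psi> x"
  shows "\<phi> = \<psi>"
proof (rule blinfun_eqI)
  fix x
  have "closed {x. blinfun_apply \<phi> x = blinfun_apply \<psi> x}"
    by (intro closed_Collect_eq continuous_intros)
  moreover have "J -` W \<subseteq> {x. blinfun_apply \<phi> x = blinfun_apply \<psi> x}" using assms by auto
  ultimately have "closure (J -` W) \<subseteq> {x. blinfun_apply \<phi> x = blinfun_apply \<psi> x}"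
    by (simp add: closure_minimal)
  then show "blinfun_apply \<phi> x = blinfun_apply \<psi> x" using dense_J_vimage by auto
qed

text \<open>This resolves the definite description in \<open>adj\<close>: a functional with the
  right values on the preimage of \<open>W\<close> is unique by density, and its norm is the
  constant required by \<open>dom_adj\<close>. Linearity of the adjoint and its kernel are both read
  off from here.\<close>

lemma adjI:
  assumes "\<And>x. J x \<in> W \<Longrightarrow> blinfun_apply \<phi> x = \<tau> \<bullet> E (J x)"
  shows "\<tau> \<in> domD" "D \<tau> = \<phi>"
proof -
  have "\<bar>\<tau> \<bullet> E u\<bar> \<le> norm \<phi> * norm u" if "u \<in> W" for u
  proof -
    obtain x where "u = J x" using W_eq_J \<open>u \<in> W\<close> by blast
    then show ?thesis using assms[of x] that norm_blinfun[of \<phi> x] by (simp add: norm_J)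
  qed
  then show "\<tau> \<in> domD" unfolding dom_adj_def using norm_ge_zero by blast
  show "D \<tau> = \<phi>" unfolding adj_def
    by (rule the_equality) (use assms in \<open>auto intro: adj_unique\<close>)
qed

text \<open>Existence of the described functional: the bound from \<open>dom_adj\<close> lets the
  form on the preimage of \<open>W\<close> be extended to its closure, which is all of
  \<open>'x0\<close>.\<close>

lemma adj_apply:
  assumes "\<tau> \<in> domD" "J x \<in> W"
  shows "blinfun_apply (D \<tau>) x = \<tau> \<bullet> E (J x)"
proof -
  obtain c where c: "\<And>u. u \<in> W \<Longrightarrow> \<bar>\<tau> \<bullet> E u\<bar> \<le> c * norm u"
    using assms(1) by (auto simp: dom_adj_def)
  have "linear_on_subspace (J -` W) (\<lambda>x. \<tau> \<bullet> E (J x))"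
    using linear_on_subspaceD[OF E] linear_subspace_vimage[OF linear_J, of W]
    by (auto simp: linear_on_subspace_def linear_add[OF linear_J] linear_scale[OF linear_J] inner_add_right)
  moreover have "norm (\<tau> \<bullet> E (J x)) \<le> c * norm x" if "x \<in> J -` W" for x
    using c[of "J x"] that by (simp add: norm_J)
  ultimately obtain F where F: "linear_on_subspace (closure (J -` W)) F"
    "\<And>x. x \<in> J -` W \<Longrightarrow> F x = \<tau> \<bullet> E (J x)"
    "\<And>x. x \<in> closure (J -` W) \<Longrightarrow> norm (F x) \<le> c * norm x"
    by (rule extend_to_closure) blast+
  then have "bounded_linear F"
    unfolding dense_J_vimage linear_on_subspace_def
    by (intro bounded_linear_intro[where K = c]) (auto simp: mult.commute)
  then have "blinfun_apply (Blinfun F) = F" by (rule bounded_linear_Blinfun_apply)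
  then show ?thesis using adjI(2)[of "Blinfun F" \<tau>] F(2) assms(2) by simp
qed

lemma dom_adj_add: "\<sigma> \<in> domD \<Longrightarrow> \<tau> \<in> domD \<Longrightarrow> \<sigma> + \<tau> \<in> domD"
  and adj_add: "\<sigma> \<in> domD \<Longrightarrow> \<tau> \<in> domD \<Longrightarrow> D (\<sigma> + \<tau>) = D \<sigma> + D \<tau>"
  using adjI[of "D \<sigma> + D \<tau>" "\<sigma> + \<tau>"] by (auto simp: adj_apply blinfun.add_left inner_add_left)

lemma dom_adj_scale: "\<tau> \<in> domD \<Longrightarrow> c *\<^sub>R \<tau> \<in> domD"
  and adj_scale: "\<tau> \<in> domD \<Longrightarrow> D (c *\<^sub>R \<tau>) = c *\<^sub>R D \<tau>"
  using adjI[of "c *\<^sub>R D \<tau>" "c *\<^sub>R \<tau>"] by (auto simp: adj_apply blinfun.scaleR_left)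

text \<open>The kernel becomes the annihilator of \<open>R\<close> in the unweighted inner product;
  membership in the domain is automatic, as the zero functional represents such a
  \<open>\<tau>\<close>.\<close>

lemma V_iff: "\<tau> \<in> V \<longleftrightarrow> (\<forall>r\<in>R. \<tau> \<bullet> r = 0)"
proof
  assume "\<tau> \<in> V"
  then have "\<tau> \<in> domD" "D \<tau> = 0" by (auto simp: V_space_def)
  then have "\<tau> \<bullet> E u = 0" if "u \<in> W" for u
    using W_eq_J[OF that] adj_apply[of \<tau>] that by auto
  then show "\<forall>r\<in>R. \<tau> \<bullet> r = 0" by auto
next
  assume "\<forall>r\<in>R. \<tau> \<bullet> r = 0"
  then show "\<tau> \<in> V" using adjI[of 0 \<tau>] by (auto simp: V_space_def)
qed

section \<open>The splitting into \<open>U\<close> and \<open>V\<close> and its projection\<close>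

lemma subspace_V: "subspace V"
  by (auto simp: subspace_def V_iff inner_add_left)

lemma U_eq: "U = C ` R"
  by (auto simp: U_space_def image_image)

lemma subspace_U: "subspace U"
  unfolding U_eq using C.linear_axioms subspace_R by (rule linear_subspace_image)

lemma U_iff: "\<sigma> \<in> U \<longleftrightarrow> inv C \<sigma> \<in> R"
  unfolding U_eq by (metis C_inv image_iff)

text \<open>The variational solution \<open>e\<close> gives \<open>u = C e\<close>, and its equation
  says exactly that the residual annihilates \<open>R\<close>.\<close>

lemma orthogonal_decomposition: "\<exists>u\<in>U. \<tau> - u \<in> V"
proof -
  obtain e where "e \<in> R" "\<forall>r\<in>R. C e \<bullet> r = \<tau> \<bullet> r"
    using coercive_variational_solution[OF C subspace_R closed_range] by blast
  then have "C e \<in> U" "\<tau> - C e \<in> V" by (auto simp: U_eq V_iff inner_diff_left)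
  then show ?thesis by blast
qed

text \<open>Such a \<open>\<tau>\<close> is \<open>C e\<close> with \<open>e\<close> in
  \<open>R\<close>, and it annihilates \<open>R\<close>, in particular \<open>e\<close> itself;
  coercivity finishes.\<close>

lemma U_inter_V: "\<tau> = 0" if "\<tau> \<in> U" "\<tau> \<in> V"
proof -
  have "C (inv C \<tau>) \<bullet> inv C \<tau> = 0" using that unfolding U_iff V_iff C_inv by blast
  then show ?thesis using coercive_eq_0 by (metis C_inv(1) C.zero)
qed

lemma decomposition_unique:
  assumes "u \<in> U" "u' \<in> U" "v \<in> V" "v' \<in> V" "u + v = u' + v'"
  shows "v = v'"
proof -
  have "v - v' = u' - u" using assms(5) by (metis add_diff_eq diff_add_cancel diff_eq_eq add.commute)
  then show ?thesis
    using U_inter_V[of "v - v'"] subspace_diff[OF subspace_V assms(3,4)]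
      subspace_diff[OF subspace_U assms(2,1)] by simp
qed

text \<open>By symmetry of \<open>C\<close> the weighted product of \<open>u\<close> and
  \<open>w\<close> is \<open>w \<bullet> inv C u\<close>, which vanishes since
  \<open>inv C u\<close> lies in \<open>R\<close>. For uniqueness the residual is tested with
  \<open>v - v'\<close>, leaving the weighted square of that difference.\<close>

lemma proj_weighted_eq:
  assumes "u \<in> U" "v \<in> V"
  shows "proj_weighted C V (u + v) = v"
  unfolding proj_weighted_def
proof (rule the_equality)
  have "inner_weighted C u w = 0" if "w \<in> V" for w
  proof -
    have "inner_weighted C u w = w \<bullet> inv C u"
      unfolding inner_weighted_def by (metis C_inv(1) C_sym inner_commute)
    moreover have "w \<bullet> inv C u = 0" using assms(1) that unfolding U_iff V_iff by blast
    ultimately show ?thesis by simp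
  qed
  then show "v \<in> V \<and> (\<forall>w\<in>V. inner_weighted C (u + v - v) w = 0)" using assms(2) by simp
  then have "inner_weighted C (u + v - v) w = 0" if "w \<in> V" for w using that by blast
  then show "v' = v" if v': "v' \<in> V \<and> (\<forall>w\<in>V. inner_weighted C (u + v - v') w = 0)" for v'
  proof -
    have mem: "v - v' \<in> V" using v' assms(2) subspace_V by (simp add: subspace_diff)
    then have "inner_weighted C (u + v - v') (v - v') = 0" "inner_weighted C u (v - v') = 0"
      using v' \<open>\<And>w. w \<in> V \<Longrightarrow> inner_weighted C u w = 0\<close> by blast+
    then have "C (inv C (v - v')) \<bullet> inv C (v - v') = 0"
      by (simp add: inner_weighted_def inner_diff_left inner_add_left)
    then have "inv C (v - v') = 0" by (rule coercive_eq_0)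
    then show ?thesis by (metis C_inv(1) C.zero eq_iff_diff_eq_0)
  qed
qed

section \<open>The operators \<open>G\<close> and \<open>Q\<close>\<close>

lemma G_in_V: "G \<tau> \<in> V" and C_minus_G: "C \<tau> - G \<tau> \<in> U"
proof -
  obtain u where u: "u \<in> U" "C \<tau> - u \<in> V" using orthogonal_decomposition by blast
  then have "G \<tau> = C \<tau> - u" using proj_weighted_eq[OF u] by (simp add: G_op_def)
  with u show "G \<tau> \<in> V" "C \<tau> - G \<tau> \<in> U" by auto
qed

lemma G_eqI:
  assumes "v \<in> V" "C \<tau> - v \<in> U"
  shows "G \<tau> = v"
  using proj_weighted_eq[OF assms(2,1)] by (simp add: G_op_def)

lemma bounded_linear_G: "bounded_linear G"
proof -
  obtain c0 where c0: "c0 > 0" and coer: "\<And>\<tau>. c0 * norm \<tau> ^ 2 \<le> C \<tau> \<bullet> \<tau>"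
    using coercive_const by blast
  obtain K where K: "K > 0" "\<And>\<tau>. norm (C \<tau>) \<le> norm \<tau> * K" using C.pos_bounded by blast
  show ?thesis
  \<comment> \<open>With \<open>C x - G x = C e\<close> and \<open>G x\<close> orthogonal to
    \<open>e\<close>, testing with \<open>e\<close> gives
    \<open>norm e \<le> norm x * K / c0\<close>. The two summands then bound \<open>C x\<close> and
    \<open>C e\<close> in \<open>G x = C x - C e\<close>.\<close>
  proof (rule bounded_linear_intro[where K = "K + K * (K / c0)"])
    show "G (x + y) = G x + G y" for x y
      using subspace_add[OF subspace_V G_in_V G_in_V] subspace_add[OF subspace_U C_minus_G C_minus_G]
      by (intro G_eqI) (auto simp: C.add algebra_simps)
    show "G (r *\<^sub>R x) = r *\<^sub>R G x" for r x
      using subspace_scale[OF subspace_V G_in_V] subspace_scale[OF subspace_U C_minus_G]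
      by (intro G_eqI) (auto simp: C.scaleR algebra_simps)
    fix x
    obtain e where e: "e \<in> R" "C x - G x = C e" using C_minus_G[of x] by (auto simp: U_eq)
    have "G x = C x - C e" using e(2) by (metis diff_diff_eq2 add_diff_cancel_left')
    moreover have "G x \<bullet> e = 0" using G_in_V e(1) unfolding V_iff by blast
    ultimately have "C e \<bullet> e = C x \<bullet> e" by (simp add: inner_diff_left)
    then have "c0 * norm e ^ 2 \<le> norm (C x) * norm e"
      using coer[of e] norm_cauchy_schwarz[of "C x" e] by simp
    then have "c0 * norm e \<le> norm (C x)"
      by (cases "e = 0") (auto simp: power2_eq_square)
    then have "norm e \<le> norm x * K / c0"
      using c0 K(2)[of x] by (simp add: field_simps)
    then have "norm (C e) \<le> norm x * K / c0 * K"
      using K by (meson mult_right_mono less_imp_le order_trans)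
    moreover have "norm (G x) \<le> norm (C x) + norm (C e)"
      unfolding \<open>G x = C x - C e\<close> by (rule norm_triangle_ineq4)
    ultimately have "norm (G x) \<le> norm x * K + norm x * K / c0 * K" using K(2)[of x] by linarith
    then show "norm (G x) \<le> norm x * (K + K * (K / c0))" by (simp add: algebra_simps)
  qed
qed

lemma inj_on_adj: "inj_on D (U \<inter> domD)"
proof (rule inj_onI)
  fix x y assume x: "x \<in> U \<inter> domD" and y: "y \<in> U \<inter> domD" and eq: "D x = D y"
  have "x + (-1) *\<^sub>R y \<in> V"
    using x y eq adj_add[of x "(-1) *\<^sub>R y"] dom_adj_add[of x "(-1) *\<^sub>R y"]
      dom_adj_scale[of y "-1"] adj_scale[of y "-1"]
    by (simp add: V_space_def)
  then have "x - y \<in> V" by simp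
  moreover have "x - y \<in> U" using x y subspace_U by (simp add: subspace_diff)
  ultimately show "x = y" using U_inter_V by fastforce
qed

lemma Q_eqI: "\<sigma> \<in> U \<Longrightarrow> \<sigma> \<in> domD \<Longrightarrow> Q (D \<sigma>) = \<sigma>"
  unfolding Q_op_def by (intro the_inv_into_f_f inj_on_adj) auto

text \<open>Surjectivity onto the image: any preimage of \<open>\<phi>\<close> may be replaced by
  its \<open>U\<close> component, because the discarded \<open>V\<close> component lies in the
  kernel of \<open>D\<close>.\<close>

lemma Q_props:
  assumes "\<phi> \<in> im_adj J W E"
  shows "Q \<phi> \<in> U" "Q \<phi> \<in> domD" "D (Q \<phi>) = \<phi>"
proof -
  obtain \<tau> where \<tau>: "\<tau> \<in> domD" "D \<tau> = \<phi>" using assms by (auto simp: im_adj_def)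
  obtain u where u: "u \<in> U" "\<tau> - u \<in> V" using orthogonal_decomposition by blast
  have dom: "(-1) *\<^sub>R (\<tau> - u) \<in> domD" and "D ((-1) *\<^sub>R (\<tau> - u)) = 0"
    using u(2) dom_adj_scale[of "\<tau> - u" "-1"] adj_scale[of "\<tau> - u" "-1"] by (auto simp: V_space_def)
  then have "u \<in> domD" "D u = \<phi>"
    using dom_adj_add[OF \<tau>(1) dom] adj_add[OF \<tau>(1) dom] \<tau>(2) by auto
  then show "Q \<phi> \<in> U" "Q \<phi> \<in> domD" "D (Q \<phi>) = \<phi>" using Q_eqI[of u] u(1) by auto
qed

text \<open>Besides additivity and homogeneity this records that \<open>im_adj J W E\<close> is a
  subspace, which the regularity transfer takes as part of
  \<open>linear_on_subspace\<close>.\<close>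

lemma Q_linear: "linear_on_subspace (im_adj J W E) Q"
proof -
  have add: "Q (\<phi> + \<psi>) = Q \<phi> + Q \<psi> \<and> \<phi> + \<psi> \<in> im_adj J W E"
    if "\<phi> \<in> im_adj J W E" "\<psi> \<in> im_adj J W E" for \<phi> \<psi>
  proof -
    note p = Q_props[OF that(1)] Q_props[OF that(2)]
    have "Q \<phi> + Q \<psi> \<in> U" "Q \<phi> + Q \<psi> \<in> domD" "D (Q \<phi> + Q \<psi>) = \<phi> + \<psi>"
      using p subspace_add[OF subspace_U] by (auto simp: dom_adj_add adj_add)
    then show ?thesis using Q_eqI[of "Q \<phi> + Q \<psi>"] by (auto simp: im_adj_def intro: rev_image_eqI)
  qed
  have scale: "Q (c *\<^sub>R \<phi>) = c *\<^sub>R Q \<phi> \<and> c *\<^sub>R \<phi> \<in> im_adj J W E"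
    if "\<phi> \<in> im_adj J W E" for \<phi> c
  proof -
    note p = Q_props[OF that(1)]
    have "c *\<^sub>R Q \<phi> \<in> U" "c *\<^sub>R Q \<phi> \<in> domD" "D (c *\<^sub>R Q \<phi>) = c *\<^sub>R \<phi>"
      using p subspace_scale[OF subspace_U] by (auto simp: dom_adj_scale adj_scale)
    then show ?thesis using Q_eqI[of "c *\<^sub>R Q \<phi>"] by (auto simp: im_adj_def intro: rev_image_eqI)
  qed
  have "0 \<in> domD" "D 0 = 0" using adjI[of 0 0] by auto
  then have "0 \<in> im_adj J W E" by (auto simp: im_adj_def intro: rev_image_eqI)
  then show ?thesis using add scale by (auto simp: linear_on_subspace_def subspace_def)
qed

text \<open>Uniform boundedness on \<open>R\<close> of the functionals \<open>e \<mapsto> \<sigma> \<bullet> e\<close> with \<open>norm (D \<sigma>) \<le> 1\<close>, which satisfy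
  \<open>\<bar>\<sigma> \<bullet> E u\<bar> \<le> norm u\<close>, replaces the open mapping theorem for \<open>E\<close>.\<close>

lemma Q_bounded: obtains K where "\<And>\<phi>. \<phi> \<in> im_adj J W E \<Longrightarrow> norm (Q \<phi>) \<le> K * norm \<phi>"
proof -
  define B where "B = {\<phi> \<in> im_adj J W E. norm \<phi> \<le> 1}"
  obtain K where K: "\<And>\<phi> r. \<phi> \<in> B \<Longrightarrow> r \<in> R \<Longrightarrow> norm (Q \<phi> \<bullet> r) \<le> K * norm r"
  proof (rule uniform_boundedness_subspace[OF subspace_R closed_range, of B "\<lambda>\<phi> r. Q \<phi> \<bullet> r"])
    show "bounded_linear (\<lambda>r. Q \<phi> \<bullet> r)" for \<phi> by (rule bounded_linear_inner_right)
    fix r assume "r \<in> R"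
    then obtain u where u: "r = E u" "u \<in> W" by auto
    then obtain x where x: "u = J x" using W_eq_J by blast
    have "norm (Q \<phi> \<bullet> r) \<le> norm x" if "\<phi> \<in> B" for \<phi>
    proof -
      have "\<phi> \<in> im_adj J W E" "norm \<phi> \<le> 1" using that by (auto simp: B_def)
      then have "Q \<phi> \<bullet> r = blinfun_apply \<phi> x" using adj_apply[OF Q_props(2)] Q_props(3) u x by simp
      also have "norm \<dots> \<le> norm \<phi> * norm x" by (rule norm_blinfun)
      also have "\<dots> \<le> 1 * norm x" using \<open>norm \<phi> \<le> 1\<close> by (intro mult_right_mono) auto
      finally show ?thesis by simp
    qed
    then show "\<exists>K. \<forall>\<phi>\<in>B. norm (Q \<phi> \<bullet> r) \<le> K" by blast
  qed blast
  obtain c0 where c0: "c0 > 0" and coer: "\<And>\<tau>. c0 * norm \<tau> ^ 2 \<le> C \<tau> \<bullet> \<tau>"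
    using coercive_const by blast
  obtain L where L: "L > 0" "\<And>\<tau>. norm (C \<tau>) \<le> norm \<tau> * L" using C.pos_bounded by blast
  \<comment> \<open>A bound tested on \<open>R\<close> alone controls the full norm because
    \<open>Q \<phi> = C e\<close> with \<open>e\<close> in \<open>R\<close>: testing with
    \<open>e\<close> itself and using coercivity bounds \<open>e\<close>, and \<open>L\<close>
    bounds \<open>C e\<close>.\<close>
  have unit: "norm (Q \<phi>) \<le> \<bar>K\<bar> / c0 * L" if "\<phi> \<in> B" for \<phi>
  proof -
    define e where "e = inv C (Q \<phi>)"
    have "e \<in> R" using that Q_props(1) by (simp add: e_def B_def flip: U_iff)
    have Ce: "C e = Q \<phi>" by (simp add: e_def)
    have "c0 * norm e ^ 2 \<le> K * norm e"
      using coer[of e] K[OF that \<open>e \<in> R\<close>] by (simp add: Ce)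
    also have "\<dots> \<le> \<bar>K\<bar> * norm e" by (intro mult_right_mono) auto
    finally have "c0 * norm e \<le> \<bar>K\<bar>" by (cases "e = 0") (auto simp: power2_eq_square)
    then have "norm e \<le> \<bar>K\<bar> / c0" using c0 by (simp add: field_simps)
    then have "norm e * L \<le> \<bar>K\<bar> / c0 * L" using L by (intro mult_right_mono) auto
    then show ?thesis using L(2)[of e] by (simp add: Ce)
  qed
  show thesis
  proof (rule that)
    fix \<phi> assume \<phi>: "\<phi> \<in> im_adj J W E"
    note D = linear_on_subspaceD[OF Q_linear]
    show "norm (Q \<phi>) \<le> (\<bar>K\<bar> / c0 * L) * norm \<phi>"
    proof (cases "\<phi> = 0")
      case True
      then show ?thesis using D(4) by simp
    next
      case False
      have "(1 / norm \<phi>) *\<^sub>R \<phi> \<in> B" using False \<phi> D(1) by (simp add: B_def subspace_scale)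
      then have "norm (Q ((1 / norm \<phi>) *\<^sub>R \<phi>)) \<le> \<bar>K\<bar> / c0 * L" by (rule unit)
      then have "norm (Q \<phi>) / norm \<phi> \<le> \<bar>K\<bar> / c0 * L" using D(3)[OF \<phi>] by simp
      then show ?thesis using False by (simp add: pos_divide_le_eq)
    qed
  qed
qed

text \<open>A common point satisfies \<open>u + G \<gamma> = Q \<phi> + v\<close> with
  \<open>u\<close>, \<open>Q \<phi>\<close> in \<open>U\<close> and \<open>G \<gamma>\<close>,
  \<open>v\<close> in \<open>V\<close>. Uniqueness of the components forces
  \<open>v = G \<gamma>\<close>.\<close>

lemma affine_intersection:
  assumes "\<phi> \<in> im_adj J W E"
  shows "(\<lambda>u. u + G \<gamma>) ` U \<inter> (\<lambda>v. v + Q \<phi>) ` V = {G \<gamma> + Q \<phi>}"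
proof -
  have "\<sigma> = G \<gamma> + Q \<phi>" if "\<sigma> = u + G \<gamma>" "\<sigma> = v + Q \<phi>" "u \<in> U" "v \<in> V" for \<sigma> u v
    using decomposition_unique[of u "Q \<phi>" "G \<gamma>" v] that Q_props(1)[OF assms] G_in_V
    by (simp add: add.commute)
  moreover have "G \<gamma> + Q \<phi> \<in> (\<lambda>u. u + G \<gamma>) ` U"
    using Q_props(1)[OF assms] by (auto simp: add.commute)
  moreover have "G \<gamma> + Q \<phi> \<in> (\<lambda>v. v + Q \<phi>) ` V"
    using G_in_V by auto
  ultimately show ?thesis by blast
qed

text \<open>The left side is the elasticity problem at one instant, with the strain replaced by
  \<open>inv C \<sigma>\<close>. Both directions rest on \<open>C \<gamma>\<close> and
  \<open>G \<gamma>\<close> differing by an element of \<open>U\<close>, which can be absorbed into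
  the image of the compatible strains.\<close>

lemma elasticity_pointwise:
  assumes "\<phi> \<in> im_adj J W E"
  shows "inv C \<sigma> \<in> (\<lambda>e. e + \<gamma>) ` R \<and> \<sigma> \<in> domD \<and> D \<sigma> = \<phi> \<longleftrightarrow> \<sigma> = G \<gamma> + Q \<phi>"
proof
  assume *: "inv C \<sigma> \<in> (\<lambda>e. e + \<gamma>) ` R \<and> \<sigma> \<in> domD \<and> D \<sigma> = \<phi>"
  then obtain e where e: "e \<in> R" "inv C \<sigma> = e + \<gamma>" by auto
  have "\<sigma> = C e + C \<gamma>" using e(2) by (metis C_inv(1) C.add)
  then have "\<sigma> = (C e + (C \<gamma> - G \<gamma>)) + G \<gamma>" by simp
  moreover have "C e + (C \<gamma> - G \<gamma>) \<in> U"
    using e(1) C_minus_G by (intro subspace_add[OF subspace_U]) (auto simp: U_eq)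
  ultimately have U: "\<sigma> \<in> (\<lambda>u. u + G \<gamma>) ` U" by blast
  note q = Q_props[OF assms]
  have "\<sigma> + (-1) *\<^sub>R Q \<phi> \<in> V"
    using * q adj_add[of \<sigma> "(-1) *\<^sub>R Q \<phi>"] dom_adj_add[of \<sigma> "(-1) *\<^sub>R Q \<phi>"]
      dom_adj_scale[of "Q \<phi>" "-1"] adj_scale[of "Q \<phi>" "-1"]
    by (simp add: V_space_def)
  then have "\<sigma> \<in> (\<lambda>v. v + Q \<phi>) ` V"
    by (intro image_eqI[of _ _ "\<sigma> - Q \<phi>"]) auto
  with U show "\<sigma> = G \<gamma> + Q \<phi>" using affine_intersection[OF assms] by blast
next
  assume \<sigma>: "\<sigma> = G \<gamma> + Q \<phi>"
  have "G \<gamma> \<in> domD" "D (G \<gamma>) = 0" using G_in_V by (auto simp: V_space_def)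
  then have "\<sigma> \<in> domD" "D \<sigma> = \<phi>"
    using Q_props[OF assms] by (auto simp: \<sigma> dom_adj_add adj_add)
  moreover have "Q \<phi> - (C \<gamma> - G \<gamma>) \<in> U"
    using Q_props(1)[OF assms] C_minus_G by (rule subspace_diff[OF subspace_U])
  then obtain e where e: "e \<in> R" "Q \<phi> - (C \<gamma> - G \<gamma>) = C e" by (auto simp: U_eq)
  then have "\<sigma> = C (e + \<gamma>)" by (simp add: \<sigma> C.add algebra_simps)
  ultimately show "inv C \<sigma> \<in> (\<lambda>e. e + \<gamma>) ` R \<and> \<sigma> \<in> domD \<and> D \<sigma> = \<phi>"
    using e(1) by auto
qed

text \<open>From left to right this is pointwise. Conversely the formula itself yields the
  regularity of \<open>\<sigma>\<close>, and bounded \<open>inv C\<close> carries it over to the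
  strain that has to be exhibited.\<close>

lemma stress_solution_iff:
  assumes g: "g \<in> W1infty 0 T UNIV" and f: "f \<in> W1infty 0 T (im_adj J W E)"
  shows "stress_solution T J W E C g f \<sigma> \<longleftrightarrow> (\<forall>t\<in>{0..T}. \<sigma> t = G (g t) + Q (f t))"
proof
  have ft: "f t \<in> im_adj J W E" if "t \<in> {0..T}" for t
    using f that by (auto simp: W1infty_def Linfty_def)
  {
    assume "stress_solution T J W E C g f \<sigma>"
    then obtain \<epsilon> where eps: "solves_elasticity T J W E C g f \<epsilon> \<sigma>" by (auto simp: stress_solution_def)
    show "\<forall>t\<in>{0..T}. \<sigma> t = G (g t) + Q (f t)"
    proof
      fix t assume t: "t \<in> {0..T}"
      then have "\<epsilon> t \<in> (\<lambda>e. e + g t) ` R" "\<sigma> t = C (\<epsilon> t)" "\<sigma> t \<in> domD" "D (\<sigma> t) = f t"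
        using eps unfolding solves_elasticity_def by blast+
      then have "inv C (\<sigma> t) \<in> (\<lambda>e. e + g t) ` R \<and> \<sigma> t \<in> domD \<and> D (\<sigma> t) = f t" by simp
      then show "\<sigma> t = G (g t) + Q (f t)" using elasticity_pointwise[OF ft[OF t]] by blast
    qed
  next
    assume eq: "\<forall>t\<in>{0..T}. \<sigma> t = G (g t) + Q (f t)"
    obtain K where "\<And>\<phi>. \<phi> \<in> im_adj J W E \<Longrightarrow> norm (Q \<phi>) \<le> K * norm \<phi>" using Q_bounded by blast
    then have "(\<lambda>t. Q (f t)) \<in> W1infty 0 T UNIV"
      using Q_linear f by (intro W1infty_linear_on_subspace)
    then have "(\<lambda>t. G (g t) + Q (f t)) \<in> W1infty 0 T UNIV"
      by (intro W1infty_add W1infty_bounded_linear[OF bounded_linear_G g])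
    then have \<sigma>: "\<sigma> \<in> W1infty 0 T UNIV" by (rule W1infty_cong[rotated]) (use eq in simp)
    then have "(\<lambda>t. inv C (\<sigma> t)) \<in> W1infty 0 T UNIV"
      by (rule W1infty_bounded_linear[OF bounded_linear_inv_C])
    moreover have "inv C (\<sigma> t) \<in> (\<lambda>e. e + g t) ` R \<and> \<sigma> t \<in> domD \<and> D (\<sigma> t) = f t"
      if "t \<in> {0..T}" for t
      using elasticity_pointwise[OF ft[OF that], of "\<sigma> t" "g t"] eq that by blast
    ultimately have "solves_elasticity T J W E C g f (\<lambda>t. inv C (\<sigma> t)) \<sigma>"
      using \<sigma> unfolding solves_elasticity_def by simp
    then show "stress_solution T J W E C g f \<sigma>" by (auto simp: stress_solution_def)
  }
qed

end

theorem theorem3p1: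
  fixes T :: real
    and W0 :: "'x::banach set"
    and E :: "'x \<Rightarrow> 'h::{real_inner, complete_space}"
    and J :: "'x0::banach \<Rightarrow> 'x"
    and C :: "'h \<Rightarrow> 'h"
    and g :: "real \<Rightarrow> 'h"
    and f :: "real \<Rightarrow> ('x0 \<Rightarrow>\<^sub>L real)"
  assumes "T > 0"
    and "reflexive_space TYPE('x)"
    and "linear_on_subspace W0 E"
    and "closed_operator W0 E"
    and "closed (E ` W0)"
    and "isometry_onto J (closure W0)"
    and "bounded_symmetric_coercive C"
    and "g \<in> W1infty 0 T UNIV"
    and "f \<in> W1infty 0 T (im_adj J W0 E)"
  shows "(\<forall>\<sigma> :: real \<Rightarrow> 'h.
            stress_solution T J W0 E C g f \<sigma> \<longleftrightarrow>
            (\<forall>t\<in>{0..T}. \<sigma> t \<in> (\<lambda>u. u + G_op J W0 E C (g t)) ` U_space W0 E C \<inter>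
                              (\<lambda>v. v + Q_op J W0 E C (f t)) ` V_space J W0 E)) \<and>
         (\<forall>t\<in>{0..T}. (\<lambda>u. u + G_op J W0 E C (g t)) ` U_space W0 E C \<inter>
                      (\<lambda>v. v + Q_op J W0 E C (f t)) ` V_space J W0 E =
                      {G_op J W0 E C (g t) + Q_op J W0 E C (f t)})"
proof -
  interpret elasticity_operators J W0 E C
    using assms(3,5,6,7) by unfold_locales
  have ft: "f t \<in> im_adj J W0 E" if "t \<in> {0..T}" for t
    using assms(9) that by (auto simp: W1infty_def Linfty_def)
  show ?thesis
    using stress_solution_iff[OF assms(8,9)] affine_intersection[OF ft] by simp
qed

end
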